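(* Let $\mathcal{A}\subseteq\mathbb{S}^n$ be a closed convex cone with $\mathbb{S}^n_+\subseteq\mathcal{A}$, $\alpha_{\mathcal{X}}(\mathcal{A})<\infty$, and $\operatorname{tr}(X)>0$ for all $X\in\mathcal{A}\setminus\{0\}$. Then, for any symmetric gauge $\phi$ on $\mathbb{R}^n$, the spectral-gauge cutting-plane method (described in the context), run with stopping tolerance $\varepsilon=0$, either terminates finitely at an optimal solution of the semidefinite program $\min\{\langle C,X\rangle:\ X\in P_{\mathrm{lin}},\ X\succeq 0\}$, or every limit point of the generated infinite sequence $(X^{(i)})_i$ is an optimal solution of this semidefinite program.
   Context: $\mathbb{S}^n$ is the space of real symmetric $n\times n$ matrices with the Frobenius inner product $\langle A,B\rangle=\operatorname{tr}(A^\top B)$; $\mathbb{S}^n_+$ is the cone of positive semidefinite matrices, and $X\succeq 0$ means $X\in\mathbb{S}^n_+$. For $X\in\mathbb{S}^n$, $\lambda(X)\in\mathbb{R}^n$ is the vector of eigenvalues in nondecreasing order with multiplicity, $\lambda_{\min}(X)=\lambda_1(X)$, and $\lambda_-(X):=(\max\{-\lambda_i(X),0\})_i$. The support of a vector is the set of indices of its nonzero components. A symmetric gauge on $\mathbb{R}^n$ is a norm $\phi$ with $\phi(z)=\phi(|z|)$ (componentwise absolute value) and $\phi(Pz)=\phi(z)$ for every permutation matrix $P$ and all $z$. Data and standing assumptions: $C\in\mathbb{S}^n$; $P_{\mathrm{lin}}\subseteq\mathbb{S}^n$ is a polyhedron; $\mathcal{F}:=P_{\mathrm{lin}}\cap\mathbb{S}^n_+\neq\varnothing$;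 there is $T>0$ with $\operatorname{tr}(X)\le T$ for all $X\in\mathcal{F}$. Let $\mathcal{R}:=\{X\in\mathbb{S}^n:\ X\in P_{\mathrm{lin}},\ X\in\mathcal{A},\ \operatorname{tr}(X)\le T\}$. For an arbitrary norm $\|\cdot\|_{\mathcal{X}}$ on $\mathbb{S}^n$, $\alpha_{\mathcal{X}}(\mathcal{A}):=\sup\{\|X\|_{\mathcal{X}}:\ X\in\mathcal{A},\ \operatorname{tr}(X)=1\}$. Spectral-gauge cutting-plane method with tolerance $\varepsilon\ge 0$: for $i=1,2,\dots$, let $X^{(i)}$ be an optimal solution of the master problem $\min\{\langle C,X\rangle:\ X\in\mathcal{R}^{(i)}\}$, where $\mathcal{R}^{(i)}:=\{X\in\mathcal{R}:\ \langle S^{(t)},X\rangle\ge 0,\ t=1,\dots,i-1\}$. Take an eigendecomposition $X^{(i)}=Q^{(i)}\operatorname{diag}(\lambda(X^{(i)}))(Q^{(i)})^\top$ with $Q^{(i)}$ orthogonal, choose $z^{(i)}\in\operatorname{argmax}\{\lambda_-(X^{(i)})^\top z:\ z\ge 0,\ \phi(z)\le 1,\ \operatorname{supp}(z)\subseteq\operatorname{supp}(\lambda_-(X^{(i)}))\}$, and set $S^{(i)}:=Q^{(i)}\operatorname{diag}(z^{(i)})(Q^{(i)})^\top$. If $\lambda_{\min}(X^{(i)})>-\varepsilon$, stop and return $X^{(i)}$; otherwise continue with $i+1$. *)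

theory Defs
  imports "HOL-Analysis.Analysis"
begin

section \<open>Symmetric matrices\<close>

text \<open>
  The synonyms allow a sort constraint on \<open>'n\<close> to be written once instead of at every occurrence.
  The inner product of the type of matrices is the Frobenius inner product.
\<close>

type_synonym 'n rvec = "(real, 'n) vec"
type_synonym 'n rmat = "((real, 'n) vec, 'n) vec"

lemma inner_matrix_eq_trace:
  fixes A B :: "real^'n^'n"
  shows "A \<bullet> B = trace (transpose A ** B)"
  unfolding inner_vec_def trace_def transpose_def matrix_matrix_mult_def
  by (simp, rule sum.swap)

definition sym_mats :: "(real^'n^'n) set"
  where "sym_mats = {X. transpose X = X}"

definition psd_cone :: "(real^'n^'n) set"
  where "psd_cone = {X \<in> sym_mats. \<forall>v. 0 \<le> v \<bullet> (X *v v)}"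

definition diag :: "real^'n \<Rightarrow> real^'n^'n"
  where "diag z = (\<chi> i j. if i = j then z $ i else 0)"

text \<open>
  The eigenvalue vector in nondecreasing order. For symmetric matrices the multiplicity of an
  eigenvalue is the dimension of its eigenspace, so the description below determines a unique
  vector; on other matrices the value is irrelevant. The linear order on the index type gives
  the enumeration \<open>1, \<dots>, n\<close> of the coordinates.
\<close>

definition eigvals :: "'n::{finite,linorder} rmat \<Rightarrow> 'n rvec"
  where "eigvals X = (THE v. mono (($) v) \<and>
           (\<forall>\<mu>. card {i. v $ i = \<mu>} = dim {x. X *v x = \<mu> *\<^sub>R x}))"

definition lambda_min :: "'n::{finite,linorder} rmat \<Rightarrow> real"
  where "lambda_min X = eigvals X $ Min UNIV"

definition eigvals_neg :: "'n::{finite,linorder} rmat \<Rightarrow> 'n rvec"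
  where "eigvals_neg X = (\<chi> i. max (- (eigvals X $ i)) 0)"

definition supp :: "real^'n \<Rightarrow> 'n set"
  where "supp z = {i. z $ i \<noteq> 0}"

section \<open>Norms and symmetric gauges\<close>

definition is_norm_on :: "'a::real_vector set \<Rightarrow> ('a \<Rightarrow> real) \<Rightarrow> bool"
  where "is_norm_on V f \<longleftrightarrow>
    (\<forall>x\<in>V. 0 \<le> f x) \<and>
    (\<forall>x\<in>V. f x = 0 \<longleftrightarrow> x = 0) \<and>
    (\<forall>x\<in>V. \<forall>c. f (c *\<^sub>R x) = \<bar>c\<bar> * f x) \<and>
    (\<forall>x\<in>V. \<forall>y\<in>V. f (x + y) \<le> f x + f y)"

definition symmetric_gauge :: "(real^'n \<Rightarrow> real) \<Rightarrow> bool"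
  where "symmetric_gauge \<phi> \<longleftrightarrow>
    is_norm_on UNIV \<phi> \<and>
    (\<forall>z. \<phi> z = \<phi> (\<chi> i. \<bar>z $ i\<bar>)) \<and>
    (\<forall>p z. bij p \<longrightarrow> \<phi> (\<chi> i. z $ p i) = \<phi> z)"

definition alpha :: "(real^'n^'n \<Rightarrow> real) \<Rightarrow> (real^'n^'n) set \<Rightarrow> ereal"
  where "alpha nrm \<A> = (SUP X \<in> {X \<in> \<A>. trace X = 1}. ereal (nrm X))"

section \<open>The semidefinite program and the cutting-plane method\<close>

definition sdp_optimal :: "real^'n^'n \<Rightarrow> (real^'n^'n) set \<Rightarrow> real^'n^'n \<Rightarrow> bool"
  where "sdp_optimal C P = is_arg_min (\<lambda>X. C \<bullet> X) (\<lambda>X. X \<in> P \<inter> psd_cone)"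

definition relaxation ::
    "(real^'n^'n) set \<Rightarrow> (real^'n^'n) set \<Rightarrow> real \<Rightarrow> (real^'n^'n) set"
  where "relaxation P \<A> T = {X \<in> sym_mats. X \<in> P \<and> X \<in> \<A> \<and> trace X \<le> T}"

text \<open>Iterations are numbered from \<open>0\<close>, so iteration \<open>i\<close> has the cuts \<open>S 0, \<dots>, S (i - 1)\<close>.\<close>

definition master_set ::
    "(real^'n^'n) set \<Rightarrow> (nat \<Rightarrow> real^'n^'n) \<Rightarrow> nat \<Rightarrow> (real^'n^'n) set"
  where "master_set R S i = {X \<in> R. \<forall>t<i. 0 \<le> S t \<bullet> X}"

definition gauge_direction ::
    "('n rvec \<Rightarrow> real) \<Rightarrow> 'n::{finite,linorder} rmat \<Rightarrow> 'n rvec \<Rightarrow> bool"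
  where "gauge_direction \<phi> X = is_arg_max (\<lambda>z. eigvals_neg X \<bullet> z)
    (\<lambda>z. (\<forall>i. 0 \<le> z $ i) \<and> \<phi> z \<le> 1 \<and> supp z \<subseteq> supp (eigvals_neg X))"

definition stops :: "real \<Rightarrow> 'n::{finite,linorder} rmat \<Rightarrow> bool"
  where "stops \<epsilon> X \<longleftrightarrow> lambda_min X > - \<epsilon>"

text \<open>
  An execution of the method, for an arbitrary choice of optimal solutions, eigendecompositions
  and maximisers. The sequences are constrained only up to and including the first iteration at
  which the stopping test succeeds; what comes after it is not part of the execution.
\<close>

definition cutting_plane_run ::
    "'n::{finite,linorder} rmat \<Rightarrow> 'n rmat set \<Rightarrow> ('n rvec \<Rightarrow> real) \<Rightarrow> real \<Rightarrow>
     (nat \<Rightarrow> 'n rmat) \<Rightarrow> (nat \<Rightarrow> 'n rmat) \<Rightarrow> (nat \<Rightarrow> 'n rvec) \<Rightarrow>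
     (nat \<Rightarrow> 'n rmat) \<Rightarrow> bool"
  where "cutting_plane_run C R \<phi> \<epsilon> X Q z S \<longleftrightarrow>
    (\<forall>i. (\<forall>j<i. \<not> stops \<epsilon> (X j)) \<longrightarrow>
       is_arg_min (\<lambda>Y. C \<bullet> Y) (\<lambda>Y. Y \<in> master_set R S i) (X i) \<and>
       orthogonal_matrix (Q i) \<and>
       X i = Q i ** diag (eigvals (X i)) ** transpose (Q i) \<and>
       gauge_direction \<phi> (X i) (z i) \<and>
       S i = Q i ** diag (z i) ** transpose (Q i))"

definition terminates_at ::
    "real \<Rightarrow> (nat \<Rightarrow> 'n::{finite,linorder} rmat) \<Rightarrow> nat \<Rightarrow> bool"
  where "terminates_at \<epsilon> X m \<longleftrightarrow> stops \<epsilon> (X m) \<and> (\<forall>j<m. \<not> stops \<epsilon> (X j))"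

definition limit_point :: "(nat \<Rightarrow> 'a::topological_space) \<Rightarrow> 'a \<Rightarrow> bool"
  where "limit_point X L \<longleftrightarrow> (\<exists>r. strict_mono r \<and> (X \<circ> r) \<longlonglongrightarrow> L)"

end

theory Submission
  imports Defs
begin

text \<open>
  Every cut has the form \<open>S = Q diag(z) Q\<^sup>T\<close> with \<open>z \<ge> 0\<close>, so it is itself positive semidefinite
  and no positive semidefinite matrix violates it. The trace bound holds on the whole feasible
  set as well, so each master problem is a relaxation of the semidefinite program and the value
  of each iterate is at most the value of each feasible point (\<open>inner_psd_nonneg\<close>). Hence an
  iterate, or a limit of iterates, is optimal as soon as it is positive semidefinite. This
  settles the case of termination, where the smallest eigenvalue is positive.

  In an infinite run, the point is that deep cuts separate iterates. Write \<open>\<kappa>\<close> for the common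
  value of the gauge on all coordinate vectors. The vector \<open>e\<^sub>i / \<kappa>\<close> competes with the maximiser
  \<open>z\<close>, so \<open>\<langle>S, X\<rangle> = - \<lambda>\<^sub>-(X)\<^sup>T z\<close> is at most \<open>- \<lambda>\<^sub>-(X)\<^sub>i / \<kappa>\<close>, while a later iterate \<open>Y\<close>
  satisfies \<open>\<langle>S, Y\<rangle> \<ge> 0\<close>. Since the Frobenius norm of \<open>S\<close> is the Euclidean norm of \<open>z\<close>, and
  that is at most \<open>n / \<kappa>\<close>, the inequality of Cauchy and Schwarz gives
  \<open>\<lambda>\<^sub>-(X)\<^sub>i \<le> n \<parallel>Y - X\<parallel>\<close>, from which the gauge has disappeared (\<open>violation_le_distance\<close>). Along a
  convergent subsequence the distances of successive terms tend to \<open>0\<close>. Therefore the quadratic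
  forms of the iterates have lower bounds that tend to \<open>0\<close>, and the form of the limit is
  nonnegative.

  The ordered eigenvalue vector enters through a unique description. That description has to be
  shown to determine a vector before the entry at the least index can be called the smallest
  one; for a matrix that is already given as \<open>Q diag(w) Q\<^sup>T\<close>, the vector is the sorted
  rearrangement of \<open>w\<close> (\<open>dim_eigenspace_spectral\<close>, \<open>sorted_rearrangement_ex1\<close>).
\<close>

section \<open>Spectral decompositions\<close>

lemma diag_mult_vec: "diag z *v x = (\<chi> i. z $ i * x $ i)"
  by (simp add: vec_eq_iff diag_def matrix_vector_mult_def if_distrib [of "\<lambda>a. a * _"] cong: if_cong)

lemma transpose_mult_vec: "transpose Q *v v = (\<chi> i. column i Q \<bullet> v)"
  unfolding transpose_def matrix_vector_mult_def column_def inner_vec_def by simp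

lemma quadratic_form_spectral:
  "v \<bullet> ((Q ** diag w ** transpose Q) *v v) = (\<Sum>i\<in>UNIV. w $ i * (column i Q \<bullet> v)\<^sup>2)"
proof -
  have "v \<bullet> ((Q ** diag w ** transpose Q) *v v) = (transpose Q *v v) \<bullet> (diag w *v (transpose Q *v v))"
    by (simp add: matrix_vector_mul_assoc [symmetric] dot_lmul_matrix [symmetric])
  also have "\<dots> = (\<Sum>i\<in>UNIV. w $ i * (column i Q \<bullet> v)\<^sup>2)"
    unfolding transpose_mult_vec diag_mult_vec
    by (simp add: inner_vec_def [of "vec_lambda _"] power2_eq_square ac_simps)
  finally show ?thesis .
qed

text \<open>
  The matrix on the left is the sum of the rank-one matrices \<open>z\<^sub>i q\<^sub>i q\<^sub>i\<^sup>T\<close>, with \<open>q\<^sub>i\<close> the columns of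
  \<open>Q\<close>. The second factor \<open>Y\<close> is arbitrary, so this serves both for testing a cut on a feasible
  matrix and, with \<open>Y\<close> diagonal in the same basis, for evaluating it at the iterate it came from.
\<close>

lemma inner_spectral:
  "(Q ** diag z ** transpose Q) \<bullet> Y = (\<Sum>i\<in>UNIV. z $ i * (column i Q \<bullet> (Y *v column i Q)))"
proof -
  have entry: "(Q ** diag z ** transpose Q) $ a $ b = (\<Sum>i\<in>UNIV. z $ i * (Q $ a $ i * Q $ b $ i))" for a b
    by (simp add: matrix_matrix_mult_def diag_def transpose_def if_distrib [of "\<lambda>a. _ * a"] ac_simps cong: if_cong)
  have "(Q ** diag z ** transpose Q) \<bullet> Y
      = (\<Sum>a\<in>UNIV. \<Sum>b\<in>UNIV. \<Sum>i\<in>UNIV. z $ i * (Q $ a $ i * (Y $ a $ b * Q $ b $ i)))"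
    by (simp add: inner_vec_def entry sum_distrib_left ac_simps)
  also have "\<dots> = (\<Sum>a\<in>UNIV. \<Sum>i\<in>UNIV. \<Sum>b\<in>UNIV. z $ i * (Q $ a $ i * (Y $ a $ b * Q $ b $ i)))"
    by (intro sum.cong refl sum.swap)
  also have "\<dots> = (\<Sum>i\<in>UNIV. \<Sum>a\<in>UNIV. \<Sum>b\<in>UNIV. z $ i * (Q $ a $ i * (Y $ a $ b * Q $ b $ i)))"
    by (rule sum.swap)
  also have "\<dots> = (\<Sum>i\<in>UNIV. z $ i * (column i Q \<bullet> (Y *v column i Q)))"
    by (simp add: inner_vec_def column_def matrix_vector_mult_def sum_distrib_left)
  finally show ?thesis .
qed

lemma orthogonal_matrix_column_inner:
  assumes "orthogonal_matrix (Q :: real^'n^'n)"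
  shows "column i Q \<bullet> column j Q = (if i = j then 1 else 0)"
proof -
  have "(transpose Q ** Q) $ i $ j = (mat 1 :: real^'n^'n) $ i $ j"
    using assms by (simp add: orthogonal_matrix)
  then show ?thesis
    by (simp add: matrix_matrix_mult_def transpose_def column_def inner_vec_def mat_def)
qed

lemma inner_spectral_same_basis:
  assumes "orthogonal_matrix (Q :: real^'n^'n)"
  shows "(Q ** diag z ** transpose Q) \<bullet> (Q ** diag w ** transpose Q) = z \<bullet> w"
proof -
  have "column i Q \<bullet> ((Q ** diag w ** transpose Q) *v column i Q) = w $ i" for i
    by (simp add: quadratic_form_spectral orthogonal_matrix_column_inner [OF assms]
        if_distrib [of "\<lambda>a. a\<^sup>2"] if_distrib [of "\<lambda>a. _ * a"] cong: if_cong)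
  then show ?thesis
    by (simp add: inner_spectral inner_vec_def [of z])
qed

lemma norm_spectral:
  assumes "orthogonal_matrix (Q :: real^'n^'n)"
  shows "norm (Q ** diag z ** transpose Q) = norm z"
  by (simp add: norm_eq_sqrt_inner inner_spectral_same_basis [OF assms])

text \<open>
  Parseval's identity for the orthonormal basis of columns.
\<close>

lemma sum_column_inner_squares:
  assumes "orthogonal_matrix (Q :: real^'n^'n)"
  shows "(\<Sum>i\<in>UNIV. (column i Q \<bullet> v)\<^sup>2) = (norm v)\<^sup>2"
proof -
  have "orthogonal_matrix (transpose Q)"
    using assms by (simp add: orthogonal_matrix_transpose)
  then have "norm (transpose Q *v v) = norm v"
    using orthogonal_transformation_matrix [of "(*v) (transpose Q)"]
    by (simp add: orthogonal_transformation)
  moreover have "(norm (transpose Q *v v))\<^sup>2 = (\<Sum>i\<in>UNIV. (column i Q \<bullet> v)\<^sup>2)"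
    unfolding transpose_mult_vec power2_norm_eq_inner
    by (simp add: inner_vec_def [of "vec_lambda _"] power2_eq_square)
  ultimately show ?thesis by simp
qed

lemma quadratic_form_lower_bound:
  assumes "orthogonal_matrix (Q :: real^'n^'n)" and "\<And>i. c \<le> w $ i"
  shows "c * (norm v)\<^sup>2 \<le> v \<bullet> ((Q ** diag w ** transpose Q) *v v)"
proof -
  have "c * (norm v)\<^sup>2 = (\<Sum>i\<in>UNIV. c * (column i Q \<bullet> v)\<^sup>2)"
    by (simp add: sum_column_inner_squares [OF assms(1), symmetric] sum_distrib_left)
  also have "\<dots> \<le> (\<Sum>i\<in>UNIV. w $ i * (column i Q \<bullet> v)\<^sup>2)"
    by (intro sum_mono mult_right_mono assms(2)) simp
  finally show ?thesis by (simp add: quadratic_form_spectral)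
qed

text \<open>
  The semidefinite cone is contained in its dual cone. For the method this says that no cut
  removes a feasible point.
\<close>

lemma inner_psd_nonneg:
  assumes "\<And>i. 0 \<le> z $ i" and "Y \<in> psd_cone"
  shows "0 \<le> (Q ** diag z ** transpose Q) \<bullet> Y"
  unfolding inner_spectral
  using assms by (intro sum_nonneg mult_nonneg_nonneg) (auto simp: psd_cone_def)

section \<open>The ordered eigenvalue vector\<close>

text \<open>
  In the coordinates \<open>y = Q\<^sup>T x\<close> the eigenvalue equation reads \<open>w\<^sub>i y\<^sub>i = \<mu> y\<^sub>i\<close> for every \<open>i\<close>, and its
  solutions are the vectors supported where \<open>w\<^sub>i = \<mu>\<close>.
\<close>

lemma dim_eigenspace_spectral:
  assumes Q: "orthogonal_matrix (Q :: real^'n^'n)"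
  shows "dim {x. (Q ** diag w ** transpose Q) *v x = \<mu> *\<^sub>R x} = card {i. w $ i = \<mu>}"
proof -
  let ?E = "{y::real^'n. \<forall>i. i \<notin> {i. w $ i = \<mu>} \<longrightarrow> y $ i = 0}"
  have QQ: "Q ** transpose Q = mat 1" "transpose Q ** Q = mat 1"
    using Q by (auto simp: orthogonal_matrix_def)
  have E: "diag w *v y = \<mu> *\<^sub>R y \<longleftrightarrow> y \<in> ?E" for y
    by (auto simp: diag_mult_vec vec_eq_iff)
  have "{x. (Q ** diag w ** transpose Q) *v x = \<mu> *\<^sub>R x} = (*v) Q ` ?E"
  proof (intro equalityI subsetI)
    fix x assume "x \<in> {x. (Q ** diag w ** transpose Q) *v x = \<mu> *\<^sub>R x}"
    then have "transpose Q *v ((Q ** diag w ** transpose Q) *v x) = transpose Q *v (\<mu> *\<^sub>R x)"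
      by simp
    then have "diag w *v (transpose Q *v x) = \<mu> *\<^sub>R (transpose Q *v x)"
      by (simp add: matrix_vector_mul_assoc matrix_mul_assoc QQ matrix_vector_mult_scaleR
          del: transpose_matrix_vector)
    then have "transpose Q *v x \<in> ?E" using E by blast
    moreover have "x = Q *v (transpose Q *v x)"
      by (simp add: matrix_vector_mul_assoc QQ del: transpose_matrix_vector)
    ultimately show "x \<in> (*v) Q ` ?E" by blast
  next
    fix x assume "x \<in> (*v) Q ` ?E"
    then obtain y where y: "x = Q *v y" "diag w *v y = \<mu> *\<^sub>R y" using E by blast
    have "(Q ** diag w ** transpose Q) *v x = Q *v (diag w *v ((transpose Q ** Q) *v y))"
      by (simp add: y(1) matrix_vector_mul_assoc matrix_mul_assoc)
    then show "x \<in> {x. (Q ** diag w ** transpose Q) *v x = \<mu> *\<^sub>R x}"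
      by (simp add: y QQ matrix_vector_mult_scaleR)
  qed
  moreover have "inj ((*v) Q)"
    by (metis QQ(2) injI matrix_vector_mul_assoc matrix_vector_mul_lid)
  then have "dim ((*v) Q ` ?E) = dim ?E"
    by (intro dim_image_eq) (auto intro: inj_on_subset)
  ultimately show ?thesis using dim_substandard_cart [where 'a = real and d = "{i. w $ i = \<mu>}"] by (simp add: dim_vec_eq)
qed

text \<open>
  Listing the index type in increasing order turns a monotone vector into a sorted list, and the
  cardinality condition says that two such lists are equal as multisets. A multiset has exactly
  one sorted list.
\<close>

lemma sorted_rearrangement_ex1:
  fixes w :: "'n::{finite,linorder} rvec"
  shows "\<exists>!v :: 'n rvec. mono (($) v) \<and> (\<forall>\<mu>. card {i. v $ i = \<mu>} = card {i. w $ i = \<mu>})"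
proof -
  define xs :: "'n list" where "xs = sorted_list_of_set UNIV"
  have xs: "set xs = UNIV" "distinct xs" "sorted xs" by (auto simp: xs_def)
  define ys where "ys = sort (map (($) w) xs)"
  have count: "count (mset (map (($) v) xs)) \<mu> = card {i. v $ i = \<mu>}" for v :: "'n rvec" and \<mu>
  proof -
    have "count (mset (map (($) v) xs)) \<mu> = length (filter (\<lambda>i. v $ i = \<mu>) xs)"
      by (induction xs) auto
    also have "\<dots> = card (set (filter (\<lambda>i. v $ i = \<mu>) xs))"
      by (rule distinct_card [symmetric]) (simp add: xs)
    finally show ?thesis by (simp add: xs)
  qed
  have char: "mono (($) v) \<and> (\<forall>\<mu>. card {i. v $ i = \<mu>} = card {i. w $ i = \<mu>})
      \<longleftrightarrow> map (($) v) xs = ys" (is "?L \<longleftrightarrow> _") for v :: "'n rvec"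
  proof
    assume L: ?L
    then have "mset (map (($) v) xs) = mset (map (($) w) xs)"
      by (intro multiset_eqI) (simp only: count)
    moreover have "sorted (map (($) v) xs)"
      using L xs(3) by (auto simp: sorted_map intro: sorted_wrt_mono_rel [rotated] dest: monoD)
    ultimately show "map (($) v) xs = ys"
      unfolding ys_def by (metis properties_for_sort)
  next
    assume eq: "map (($) v) xs = ys"
    have "v $ i \<le> v $ j" if "i \<le> j" for i j
    proof -
      obtain a b where a: "a < length xs" "i = xs ! a" and b: "b < length xs" "j = xs ! b"
        using xs(1) by (metis UNIV_I in_set_conv_nth)
      show ?thesis
      proof (cases "a \<le> b")
        case True
        have "sorted (map (($) v) xs)" by (simp add: eq ys_def)
        then have "map (($) v) xs ! a \<le> map (($) v) xs ! b"
          using True b by (intro sorted_nth_mono) auto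
        then show ?thesis using a b by simp
      next
        case False
        then have "j \<le> i" using xs(3) a b by (simp add: sorted_nth_mono)
        then show ?thesis using that by simp
      qed
    qed
    moreover have "mset (map (($) v) xs) = mset (map (($) w) xs)"
      unfolding eq ys_def by simp
    ultimately show ?L by (metis count monoI)
  qed
  have "\<exists>v :: 'n rvec. map (($) v) xs = ys"
  proof
    show "map (($) (\<chi> i. the (map_of (zip xs ys) i))) xs = ys"
      by (rule nth_equalityI)
        (use xs(2) in \<open>auto simp: ys_def map_of_zip_nth\<close>)
  qed
  moreover have "v = v'" if "map (($) v) xs = ys" "map (($) v') xs = ys" for v v' :: "'n rvec"
    using that xs(1) by (metis UNIV_I map_eq_conv vec_eq_iff)
  ultimately show ?thesis unfolding char by blast
qed

text \<open>
  Some orthogonal diagonalisation is enough to know that the definite description behind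
  \<^const>\<open>eigvals\<close> is proper; \<open>w\<close> may list the eigenvalues in any order.
\<close>

lemma lambda_min_le_eigvals:
  assumes "orthogonal_matrix Q" and "X = Q ** diag w ** transpose Q"
  shows "lambda_min X \<le> eigvals X $ i"
proof -
  have "mono (($) (eigvals X))"
    using theI' [OF sorted_rearrangement_ex1 [of w]]
    unfolding eigvals_def assms(2) dim_eigenspace_spectral [OF assms(1)] by blast
  then show ?thesis
    unfolding lambda_min_def by (rule monoD) simp
qed

section \<open>Symmetric gauges\<close>

lemma symmetric_gauge_axis_eq:
  assumes "symmetric_gauge \<phi>"
  shows "\<phi> (axis i 1) = \<phi> (axis j 1)"
proof -
  have "(\<chi> k. axis i (1::real) $ Transposition.transpose i j k) = axis j 1"
    by (auto simp: vec_eq_iff axis_def Transposition.transpose_def)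
  then show ?thesis
    using assms unfolding symmetric_gauge_def
    by (metis bij_transpose)
qed

lemma symmetric_gauge_axis_pos:
  assumes "symmetric_gauge \<phi>"
  shows "0 < \<phi> (axis i 1)"
  using assms by (auto simp: symmetric_gauge_def is_norm_on_def less_le axis_eq_0_iff)

text \<open>
  Flipping the sign of all coordinates but the \<open>i\<close>-th preserves the gauge, and the average of \<open>z\<close>
  and its flipped copy is \<open>z\<^sub>i e\<^sub>i\<close>.
\<close>

lemma abs_component_le_symmetric_gauge:
  assumes "symmetric_gauge \<phi>"
  shows "\<bar>z $ i\<bar> * \<phi> (axis i 1) \<le> \<phi> z"
proof -
  define z' where "z' = (\<chi> k. if k = i then z $ k else - z $ k)"
  have "\<phi> z' = \<phi> (\<chi> k. \<bar>z' $ k\<bar>)" "\<phi> z = \<phi> (\<chi> k. \<bar>z $ k\<bar>)"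
    using assms by (auto simp: symmetric_gauge_def)
  moreover have "(\<chi> k. \<bar>z' $ k\<bar>) = (\<chi> k. \<bar>z $ k\<bar>)"
    by (simp add: vec_eq_iff z'_def)
  ultimately have "\<phi> z' = \<phi> z" by simp
  moreover have "\<phi> (z + z') \<le> \<phi> z + \<phi> z'"
    using assms by (simp add: symmetric_gauge_def is_norm_on_def)
  moreover have "z + z' = (2 * z $ i) *\<^sub>R axis i 1"
    by (simp add: vec_eq_iff z'_def axis_def)
  moreover have "\<phi> ((2 * z $ i) *\<^sub>R axis i 1) = \<bar>2 * z $ i\<bar> * \<phi> (axis i 1)"
    using assms unfolding symmetric_gauge_def is_norm_on_def by blast
  ultimately show ?thesis by simp
qed

text \<open>
  The gauge ball has Euclidean radius at most \<open>n / \<phi>(e\<^sub>k)\<close>. Keeping the factor \<open>\<phi>(e\<^sub>k)\<close> on the left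
  lets it cancel against the one in the lower bound for the depth of a cut.
\<close>

lemma norm_mult_gauge_axis_le:
  fixes z :: "real^'n" and \<phi> :: "real^'n \<Rightarrow> real"
  assumes "symmetric_gauge \<phi>"
  shows "norm z * \<phi> (axis k 1) \<le> CARD('n) * \<phi> z"
proof -
  have "norm z * \<phi> (axis k 1) \<le> (\<Sum>i\<in>UNIV. \<bar>z $ i\<bar>) * \<phi> (axis k 1)"
    using norm_le_l1_cart symmetric_gauge_axis_pos [OF assms, of k] by (intro mult_right_mono) auto
  also have "\<dots> = (\<Sum>i\<in>UNIV. \<bar>z $ i\<bar> * \<phi> (axis i 1))"
    unfolding sum_distrib_right by (intro sum.cong refl arg_cong2 [where f = "(*)"] symmetric_gauge_axis_eq assms)
  also have "\<dots> \<le> (\<Sum>i\<in>(UNIV::'n set). \<phi> z)"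
    by (intro sum_mono abs_component_le_symmetric_gauge assms)
  finally show ?thesis by simp
qed

section \<open>Depth of the cuts\<close>

text \<open>
  The normalised coordinate vector \<open>e\<^sub>i / \<phi>(e\<^sub>i)\<close> is a competitor of \<open>z\<close>.
\<close>

lemma eigvals_neg_le_gauge_value:
  assumes g: "symmetric_gauge \<phi>" and z: "gauge_direction \<phi> X z"
  shows "eigvals_neg X $ i \<le> \<phi> (axis i 1) * (eigvals_neg X \<bullet> z)"
proof -
  let ?\<kappa> = "\<phi> (axis i 1)"
  have \<kappa>: "0 < ?\<kappa>" by (rule symmetric_gauge_axis_pos [OF g])
  have scale: "\<phi> (c *\<^sub>R x) = \<bar>c\<bar> * \<phi> x" for c x
    using g unfolding symmetric_gauge_def is_norm_on_def by blast
  \<comment> \<open>The case \<open>0\<close> keeps the competitor inside the support of the negative eigenvalues.\<close>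
  define t where "t = (if eigvals_neg X $ i = 0 then 0 else (1 / ?\<kappa>) *\<^sub>R axis i (1::real))"
  have "\<forall>k. 0 \<le> t $ k" using \<kappa> by (auto simp: t_def axis_def)
  moreover have "\<phi> t \<le> 1"
    using \<kappa> scale [of 0 0] scale [of "1 / ?\<kappa>" "axis i 1"] by (auto simp: t_def)
  moreover have "supp t \<subseteq> supp (eigvals_neg X)"
    by (auto simp: t_def supp_def axis_def split: if_splits)
  ultimately have "eigvals_neg X \<bullet> t \<le> eigvals_neg X \<bullet> z"
    using z unfolding gauge_direction_def is_arg_max_linorder by blast
  moreover have "eigvals_neg X \<bullet> t = eigvals_neg X $ i / ?\<kappa>"
    by (simp add: t_def inner_axis)
  ultimately show ?thesis using \<kappa> by (simp add: field_simps)
qed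

text \<open>
  On the support of \<open>z\<close> only negative eigenvalues occur, where \<open>\<lambda>\<^sub>- = - \<lambda>\<close>. The support condition
  is essential: without it \<open>z\<close> could put weight on positive eigenvalues and make the cut shallow.
\<close>

lemma gauge_direction_inner_eigvals:
  assumes "gauge_direction \<phi> X z"
  shows "z \<bullet> eigvals X = - (eigvals_neg X \<bullet> z)"
proof -
  have "z $ i * eigvals X $ i = - (eigvals_neg X $ i * z $ i)" for i
    using assms
    by (cases "z $ i = 0") (auto simp: gauge_direction_def is_arg_max_def supp_def eigvals_neg_def max_def split: if_splits)
  then show ?thesis by (simp add: inner_vec_def sum_negf)
qed

text \<open>
  A point \<open>Y\<close> that satisfies the cut generated at \<open>X\<close> is at a distance from \<open>X\<close> proportional to
  the infeasibility of \<open>X\<close>. The lower bound for the depth of the cut carries the factor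
  \<open>1 / \<phi>(e\<^sub>i)\<close> and so does the bound for its norm; the constant is therefore the same for all
  gauges.
\<close>

lemma violation_le_distance:
  fixes X Y :: "'n::{finite,linorder} rmat"
  assumes g: "symmetric_gauge \<phi>" and z: "gauge_direction \<phi> X z"
    and Q: "orthogonal_matrix Q" "X = Q ** diag (eigvals X) ** transpose Q"
    and Y: "0 \<le> (Q ** diag z ** transpose Q) \<bullet> Y"
  shows "eigvals_neg X $ i \<le> CARD('n) * norm (Y - X)"
proof -
  let ?S = "Q ** diag z ** transpose Q" and ?\<kappa> = "\<phi> (axis i 1)"
  have \<kappa>: "0 < ?\<kappa>" by (rule symmetric_gauge_axis_pos [OF g])
  have "\<phi> z \<le> 1" using z by (simp add: gauge_direction_def is_arg_max_def)
  have "?S \<bullet> X = - (eigvals_neg X \<bullet> z)"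
    using inner_spectral_same_basis [OF Q(1), of z "eigvals X"] Q(2) gauge_direction_inner_eigvals [OF z]
    by simp
  then have "eigvals_neg X \<bullet> z \<le> ?S \<bullet> (Y - X)"
    using Y by (simp add: inner_diff_right)
  also have "\<dots> \<le> norm z * norm (Y - X)"
    using norm_cauchy_schwarz [of ?S "Y - X"] by (simp add: norm_spectral [OF Q(1)])
  finally have "?\<kappa> * (eigvals_neg X \<bullet> z) \<le> (norm z * ?\<kappa>) * norm (Y - X)"
    using \<kappa> by (simp add: mult.assoc mult.left_commute)
  also have "\<dots> \<le> (CARD('n) * \<phi> z) * norm (Y - X)"
    by (intro mult_right_mono norm_mult_gauge_axis_le g) simp
  also have "\<dots> \<le> (CARD('n) * 1) * norm (Y - X)"
    using \<open>\<phi> z \<le> 1\<close> by (intro mult_right_mono mult_left_mono) auto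
  finally show ?thesis
    using eigvals_neg_le_gauge_value [OF g z, of i] by simp
qed

section \<open>Convergence\<close>

theorem theorem5p2:
  fixes C :: "'n::{finite,linorder} rmat"
    and P \<A> :: "'n rmat set"
    and T :: real
    and normX :: "'n rmat \<Rightarrow> real"
    and \<phi> :: "'n rvec \<Rightarrow> real"
    and X Q S :: "nat \<Rightarrow> 'n rmat"
    and z :: "nat \<Rightarrow> 'n rvec"
  assumes C: "C \<in> sym_mats"
    and P: "P \<subseteq> sym_mats" "polyhedron P"
    and feasible: "P \<inter> psd_cone \<noteq> {}"
    and T: "T > 0" "\<forall>Y \<in> P \<inter> psd_cone. trace Y \<le> T"
    and cone: "\<A> \<subseteq> sym_mats" "closed \<A>" "convex_cone \<A>" "psd_cone \<subseteq> \<A>"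
    and normX: "is_norm_on sym_mats normX"
    and alpha_finite: "alpha normX \<A> < \<infinity>"
    and trace_pos: "\<forall>Y \<in> \<A> - {0}. trace Y > 0"
    and gauge: "symmetric_gauge \<phi>"
    and run: "cutting_plane_run C (relaxation P \<A> T) \<phi> 0 X Q z S"
  shows "(\<exists>m. terminates_at 0 X m \<and> sdp_optimal C P (X m)) \<or>
         ((\<forall>i. \<not> stops 0 (X i)) \<and> (\<forall>L. limit_point X L \<longrightarrow> sdp_optimal C P L))"
proof -
  let ?run = "\<lambda>i. \<forall>j<i. \<not> stops 0 (X j)"
  have opt: "is_arg_min (\<lambda>Y. C \<bullet> Y) (\<lambda>Y. Y \<in> master_set (relaxation P \<A> T) S i) (X i)"
    and Q: "orthogonal_matrix (Q i)" "X i = Q i ** diag (eigvals (X i)) ** transpose (Q i)"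
    and z: "gauge_direction \<phi> (X i) (z i)"
    and S: "S i = Q i ** diag (z i) ** transpose (Q i)" if "?run i" for i
    using run that unfolding cutting_plane_run_def by blast+
  have XP: "X i \<in> P" if "?run i" for i
    using opt [OF that] by (simp add: is_arg_min_def master_set_def relaxation_def)
  have lower_bound: "C \<bullet> X i \<le> C \<bullet> Y" if i: "?run i" and Y: "Y \<in> P \<inter> psd_cone" for i Y
  proof -
    have "0 \<le> S t \<bullet> Y" if "t < i" for t
    proof -
      have t: "?run t" using i that by simp
      show ?thesis
        unfolding S [OF t] using z [OF t] Y
        by (intro inner_psd_nonneg) (auto simp: gauge_direction_def is_arg_max_def)
    qed
    then have "Y \<in> master_set (relaxation P \<A> T) S i"
      using Y T(2) cone(4) by (auto simp: master_set_def relaxation_def psd_cone_def)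
    then show ?thesis
      using opt [OF i] by (auto simp: is_arg_min_linorder)
  qed
  show ?thesis
  proof (cases "\<exists>m. stops 0 (X m)")
    case True
    \<comment> \<open>The run constrains the iterates only up to the first successful test.\<close>
    define m where "m = (LEAST m. stops 0 (X m))"
    have m: "stops 0 (X m)" "?run m"
      using LeastI_ex [OF True] not_less_Least unfolding m_def by blast+
    have "0 \<le> eigvals (X m) $ i" for i
      using lambda_min_le_eigvals [OF Q [OF m(2)], of i] m(1) by (simp add: stops_def)
    then have "0 \<le> v \<bullet> (X m *v v)" for v
      using quadratic_form_lower_bound [OF Q(1) [OF m(2)], of 0 "eigvals (X m)" v] Q(2) [OF m(2)]
      by simp
    then have "X m \<in> P \<inter> psd_cone"
      using XP [OF m(2)] P(1) by (auto simp: psd_cone_def)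
    then have "sdp_optimal C P (X m)"
      using lower_bound [OF m(2)] by (simp add: sdp_optimal_def is_arg_min_linorder)
    then show ?thesis using m by (auto simp: terminates_at_def)
  next
    case False
    then have all: "?run i" for i by blast
    have "sdp_optimal C P L" if L: "limit_point X L" for L
    proof -
      obtain r where r: "strict_mono r" "(X \<circ> r) \<longlonglongrightarrow> L"
        using L by (auto simp: limit_point_def)
      have lim: "(\<lambda>k. X (r k)) \<longlonglongrightarrow> L" using r(2) by (simp add: o_def)
      have LP: "L \<in> P"
        using closed_sequentially [OF polyhedron_imp_closed [OF P(2)] _ lim] XP [OF all] by blast
      have approx: "- (CARD('n) * norm (X (r (Suc k)) - X (r k))) * (norm v)\<^sup>2 \<le> v \<bullet> (X (r k) *v v)"
        for k v
      proof -
        \<comment> \<open>The next term of the subsequence is a later iterate, so the cut made at this term binds it.\<close>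
        have "r k < r (Suc k)" using r(1) by (simp add: strict_mono_Suc_iff)
        then have "0 \<le> S (r k) \<bullet> X (r (Suc k))"
          using opt [OF all, of "r (Suc k)"] by (simp add: is_arg_min_def master_set_def)
        then have "eigvals_neg (X (r k)) $ i \<le> CARD('n) * norm (X (r (Suc k)) - X (r k))" for i
          unfolding S [OF all] by (rule violation_le_distance [OF gauge z [OF all] Q [OF all]])
        then have "- (CARD('n) * norm (X (r (Suc k)) - X (r k))) \<le> eigvals (X (r k)) $ i" for i
          by (simp add: eigvals_neg_def) (smt (verit))
        then show ?thesis
          using quadratic_form_lower_bound [OF Q(1) [OF all]] Q(2) [OF all] by metis
      qed
      have "0 \<le> v \<bullet> (L *v v)" for v
      proof (rule LIMSEQ_le)
        \<comment> \<open>The quadratic form at \<open>v\<close> is linear in the matrix: it is the inner product with \<open>v v\<^sup>T\<close>.\<close>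
        have "v \<bullet> (M *v v) = M \<bullet> (\<chi> a b. v $ a * v $ b)" for M :: "'n rmat"
          by (simp add: inner_vec_def matrix_vector_mult_def sum_distrib_left ac_simps)
        then show "(\<lambda>k. v \<bullet> (X (r k) *v v)) \<longlonglongrightarrow> v \<bullet> (L *v v)"
          by (simp add: tendsto_inner lim)
        have "(\<lambda>k. - (CARD('n) * norm (X (r (Suc k)) - X (r k))) * (norm v)\<^sup>2)
            \<longlonglongrightarrow> - (CARD('n) * norm (L - L)) * (norm v)\<^sup>2"
          by (intro tendsto_intros lim LIMSEQ_Suc)
        then show "(\<lambda>k. - (CARD('n) * norm (X (r (Suc k)) - X (r k))) * (norm v)\<^sup>2) \<longlonglongrightarrow> 0"
          by simp
        show "\<exists>N. \<forall>k\<ge>N. - (CARD('n) * norm (X (r (Suc k)) - X (r k))) * (norm v)\<^sup>2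
            \<le> v \<bullet> (X (r k) *v v)"
          using approx by blast
      qed
      then have "L \<in> P \<inter> psd_cone"
        using LP P(1) by (auto simp: psd_cone_def)
      moreover have "C \<bullet> L \<le> C \<bullet> Y" if "Y \<in> P \<inter> psd_cone" for Y
        by (rule LIMSEQ_le_const2 [OF tendsto_inner [OF tendsto_const lim]])
          (use lower_bound [OF all that] in blast)
      ultimately show ?thesis by (simp add: sdp_optimal_def is_arg_min_linorder)
    qed
    then show ?thesis using False by blast
  qed
qed

end
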